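(* Let $\langle\cdot,\cdot\rangle$ be an arbitrary inner product of signature $(2,1)$ on the three-dimensional Heisenberg Lie algebra $\mathfrak{h}_3$. Then there exist $k>0$, $\lambda\in\{0,1,2\}$, and a basis $\{x_1,x_2,x_3\}$ of $\mathfrak{h}_3$ which is pseudo-orthonormal with respect to $k\langle\cdot,\cdot\rangle$ such that $$[x_1,x_2]=\lambda(x_1+\lambda x_3),\quad [x_2,x_3]=x_1+\lambda x_3,\quad [x_3,x_1]=0.$$
   Context: $\mathfrak{h}_3$ is the real Lie algebra with basis $\{e_1,e_2,e_3\}$ whose only nonzero bracket (up to skew-symmetry) is $[e_2,e_3]=e_1$. An inner product means a nondegenerate symmetric bilinear form, not necessarily positive definite; signature $(2,1)$ means two positive and one negative directions. A basis $\{x_1,x_2,x_3\}$ is pseudo-orthonormal with respect to an inner product $\langle\cdot,\cdot\rangle$ of signature $(2,1)$ if $\langle x_i,x_j\rangle=\varepsilon_i\delta_{ij}$ with $\varepsilon_1=\varepsilon_2=1$ and $\varepsilon_3=-1$ (the ordering matters). *)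

theory Defs
  imports "HOL-Analysis.Analysis"
begin

text \<open>The Heisenberg algebra is modelled on \<^typ>\<open>real^3\<close> with \<open>e\<^sub>i = axis i 1\<close>; the bracket is the
  bilinear alternating extension of \<open>[e\<^sub>2, e\<^sub>3] = e\<^sub>1\<close>.  The Euclidean structure of
  \<^typ>\<open>real^3\<close> plays no role.\<close>

definition heis_bracket :: "real^3 \<Rightarrow> real^3 \<Rightarrow> real^3" where
  "heis_bracket x y = (x $ 2 * y $ 3 - x $ 3 * y $ 2) *\<^sub>R axis 1 1"

lemma bilinear_heis_bracket: "bilinear heis_bracket"
  by (auto simp: bilinear_def linear_iff heis_bracket_def vec_eq_iff algebra_simps)

lemma heis_bracket_self: "heis_bracket x x = 0"
  by (simp add: heis_bracket_def)

lemma heis_bracket_Jacobi: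
  "heis_bracket x (heis_bracket y z) + heis_bracket y (heis_bracket z x)
     + heis_bracket z (heis_bracket x y) = 0"
  by (simp add: heis_bracket_def axis_def)

lemma heis_bracket_basis:
  "heis_bracket (axis 2 1) (axis 3 1) = axis 1 1"
  "heis_bracket (axis 1 1) (axis 2 1) = 0"
  "heis_bracket (axis 3 1) (axis 1 1) = 0"
  by (simp_all add: heis_bracket_def axis_def)

definition inner_product :: "('a::euclidean_space \<Rightarrow> 'a \<Rightarrow> real) \<Rightarrow> bool" where
  "inner_product B \<longleftrightarrow>
     bilinear B \<and> (\<forall>x y. B x y = B y x) \<and> (\<forall>x. (\<forall>y. B x y = 0) \<longrightarrow> x = 0)"

text \<open>The signature is the pair of inertia indices: the largest dimension of a subspace on which
  the form is positive definite, respectively negative definite.\<close>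

definition positive_index :: "('a::euclidean_space \<Rightarrow> 'a \<Rightarrow> real) \<Rightarrow> nat" where
  "positive_index B = Max {dim S |S. subspace S \<and> (\<forall>x\<in>S. x \<noteq> 0 \<longrightarrow> B x x > 0)}"

definition negative_index :: "('a::euclidean_space \<Rightarrow> 'a \<Rightarrow> real) \<Rightarrow> nat" where
  "negative_index B = Max {dim S |S. subspace S \<and> (\<forall>x\<in>S. x \<noteq> 0 \<longrightarrow> B x x < 0)}"

definition signature :: "('a::euclidean_space \<Rightarrow> 'a \<Rightarrow> real) \<Rightarrow> nat \<times> nat" where
  "signature B = (positive_index B, negative_index B)"

text \<open>The two sets of dimensions are finite and nonempty, so that \<^const>\<open>Max\<close> is meaningful.\<close>

lemma finite_definite_dims:
  fixes P :: "'a::euclidean_space \<Rightarrow> bool"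
  shows "finite {dim S |S. subspace S \<and> (\<forall>x\<in>S. x \<noteq> 0 \<longrightarrow> P x)}"
  by (rule finite_subset[of _ "{..DIM('a)}"]) (auto simp: dim_subset_UNIV)

lemma zero_in_definite_dims:
  fixes P :: "'a::euclidean_space \<Rightarrow> bool"
  shows "0 \<in> {dim S |S. subspace S \<and> (\<forall>x\<in>S. x \<noteq> 0 \<longrightarrow> P x)}"
  by (auto intro!: exI[of _ "{0}"] simp: subspace_0 subspace_def)

text \<open>The index type \<^typ>\<open>3\<close> has the elements \<open>1\<close>, \<open>2\<close> and \<open>3\<close> (where \<open>3 = 0\<close>).\<close>

definition pseudo_orthonormal_basis ::
    "('a::euclidean_space \<Rightarrow> 'a \<Rightarrow> real) \<Rightarrow> (3 \<Rightarrow> 'a) \<Rightarrow> bool" where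
  "pseudo_orthonormal_basis B x \<longleftrightarrow>
     inj x \<and> independent (range x) \<and> span (range x) = UNIV \<and>
     (\<forall>i j. B (x i) (x j) = (if i = j then (if i = 3 then - 1 else 1) else 0))"

end

theory Submission
  imports Defs
begin

text \<open>An orthonormal triple \<open>z\<^sub>1, z\<^sub>2, z\<^sub>3\<close> for the form exists by Gram--Schmidt on a maximal positive
  definite plane.  A rotation in the plane of \<open>z\<^sub>1, z\<^sub>2\<close> and the reflection \<open>z\<^sub>3 \<mapsto> - z\<^sub>3\<close> bring the
  central vector \<open>e\<^sub>1\<close> to the form \<open>r z\<^sub>1 + c z\<^sub>3\<close> with \<open>r, c \<ge> 0\<close>.  A Lorentz boost in the plane
  of \<open>z\<^sub>1, z\<^sub>3\<close> then makes \<open>z\<^sub>1 + l z\<^sub>3\<close> a positive multiple of \<open>e\<^sub>1\<close>, where \<open>l\<close> is \<open>0\<close>, \<open>1\<close> or \<open>2\<close>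
  according to whether \<open>e\<^sub>1\<close> is spacelike, lightlike or timelike.  Since \<open>e\<^sub>1\<close> is central, this fixes
  all brackets up to the single number \<open>[z\<^sub>2, z\<^sub>3]\<close>, which is adjusted by scaling the form.\<close>

text \<open>The last vector is the timelike one. Only one entry of each off-diagonal pair of the
  Gram matrix is listed; symmetry of \<open>B\<close> supplies the other.\<close>

definition orthonormal_triple :: "('a::real_vector \<Rightarrow> 'a \<Rightarrow> real) \<Rightarrow> 'a \<Rightarrow> 'a \<Rightarrow> 'a \<Rightarrow> bool" where
  "orthonormal_triple B x y z \<longleftrightarrow>
     B x x = 1 \<and> B y y = 1 \<and> B z z = - 1 \<and> B x y = 0 \<and> B x z = 0 \<and> B y z = 0"

lemmas bilinear_simps =
  bilinear_ladd bilinear_radd bilinear_lmul bilinear_rmul bilinear_lneg bilinear_rneg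
  bilinear_lsub bilinear_rsub bilinear_lzero bilinear_rzero

lemma bilinear_scale: "bilinear B \<Longrightarrow> bilinear (\<lambda>u v. k * B u v)"
  for B :: "'a::real_vector \<Rightarrow> 'b::real_vector \<Rightarrow> real"
  by (auto simp: bilinear_def linear_iff algebra_simps)

text \<open>A vector in the span of the others would be \<open>B\<close>-orthogonal to itself,
  contradicting \<open>nz\<close>. No definiteness enters, so the argument covers indefinite
  forms.\<close>

lemma independent_range_if_orthogonal:
  fixes B :: "'a::euclidean_space \<Rightarrow> 'a \<Rightarrow> real"
  assumes B: "bilinear B"
    and orth: "\<And>i j. i \<noteq> j \<Longrightarrow> B (x i) (x j) = 0" and nz: "\<And>i. B (x i) (x i) \<noteq> 0"
  shows "inj x" and "independent (range x)"
proof -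
  show "inj x"
    using orth nz by (metis injI)
  show "independent (range x)"
    unfolding dependent_def
  proof clarify
    fix i assume *: "x i \<in> span (range x - {x i})"
    have "B (x i) (x i) = 0"
      using * by (rule span_induct)
        (auto simp: subspace_def bilinear_simps[OF B] intro: orth)
    with nz show False by blast
  qed
qed

lemma pseudo_orthonormal_basis_of_triple:
  fixes B :: "real^3 \<Rightarrow> real^3 \<Rightarrow> real"
  assumes B: "bilinear B" and sym: "\<And>u v. B u v = B v u"
    and triple: "orthonormal_triple B (x 1) (x 2) (x 3)"
  shows "pseudo_orthonormal_basis B x"
proof -
  have *: "\<forall>i j. B (x i) (x j) = (if i = j then (if i = 3 then - 1 else 1) else 0)"
    using triple sym unfolding forall_3 orthonormal_triple_def by simp
  have x: "inj x" "independent (range x)"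
    by (rule independent_range_if_orthogonal[OF B]; simp add: *)+
  have "card (range x) = 3"
    using x(1) by (simp add: card_image)
  then have "span (range x) = UNIV"
    using card_ge_dim_independent[of "range x" UNIV] x(2) by auto
  with x * show ?thesis
    by (simp add: pseudo_orthonormal_basis_def)
qed

lemma orthonormal_triple_expansion:
  fixes B :: "real^3 \<Rightarrow> real^3 \<Rightarrow> real"
  assumes B: "bilinear B" and sym: "\<And>u v. B u v = B v u"
    and triple: "orthonormal_triple B x y z"
  obtains a b c where "v = a *\<^sub>R x + b *\<^sub>R y + c *\<^sub>R z"
proof -
  define f :: "3 \<Rightarrow> real^3" where "f i = (if i = 1 then x else if i = 2 then y else z)" for i
  have "pseudo_orthonormal_basis B f"
    by (rule pseudo_orthonormal_basis_of_triple[OF B sym]) (simp add: f_def triple)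
  then have "v \<in> span (range f)"
    by (simp add: pseudo_orthonormal_basis_def)
  also have "range f = {x, y, z}"
    unfolding UNIV_3 by (auto simp: f_def)
  finally show ?thesis
    by (auto simp: span_insert algebra_simps intro: that)
qed

lemma ex_orthonormal_triple:
  fixes B :: "'a::euclidean_space \<Rightarrow> 'a \<Rightarrow> real"
  assumes B: "bilinear B" and sym: "\<And>u v. B u v = B v u" and sig: "signature B = (2, 1)"
  shows "\<exists>x y z. orthonormal_triple B x y z"
proof -
  note B_simps = bilinear_simps[OF B]
  \<comment> \<open>The set of dimensions is finite and contains \<open>0\<close>, so its maximum is
    attained by an actual subspace.\<close>
  have "positive_index B \<in> {dim S |S. subspace S \<and> (\<forall>x\<in>S. x \<noteq> 0 \<longrightarrow> B x x > 0)}"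
    unfolding positive_index_def
    using zero_in_definite_dims[of "\<lambda>x. B x x > 0"]
    by (intro Max_in[OF finite_definite_dims[of "\<lambda>x. B x x > 0"]]) (metis empty_iff)
  then obtain S where S: "subspace S" "dim S = 2" and pos: "\<And>x. x \<in> S \<Longrightarrow> x \<noteq> 0 \<Longrightarrow> B x x > 0"
    using sig by (auto simp: signature_def)
  have "negative_index B \<in> {dim S |S. subspace S \<and> (\<forall>x\<in>S. x \<noteq> 0 \<longrightarrow> B x x < 0)}"
    unfolding negative_index_def
    using zero_in_definite_dims[of "\<lambda>x. B x x < 0"]
    by (intro Max_in[OF finite_definite_dims[of "\<lambda>x. B x x < 0"]]) (metis empty_iff)
  then obtain N where N: "dim N = 1" and neg: "\<And>x. x \<in> N \<Longrightarrow> x \<noteq> 0 \<Longrightarrow> B x x < 0"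
    using sig by (auto simp: signature_def)
  \<comment> \<open>The absolute value lets one identity serve both spacelike and timelike
    vectors.\<close>
  have normalise: "B (v /\<^sub>R sqrt \<bar>B v v\<bar>) (v /\<^sub>R sqrt \<bar>B v v\<bar>) = sgn (B v v)" for v
    by (simp add: B_simps sgn_real_def flip: mult.assoc inverse_mult_distrib)
  obtain b1 b2 where b: "b1 \<in> S" "b2 \<in> S" "b1 \<noteq> b2" "independent {b1, b2}"
  proof -
    obtain A where "A \<subseteq> S" "independent A" "card A = 2"
      using basis_exists[of S] S by metis
    then show ?thesis
      by (auto simp: card_2_iff intro: that)
  qed
  define x where "x = b1 /\<^sub>R sqrt \<bar>B b1 b1\<bar>"
  have "b1 \<noteq> 0"
    using b(4) dependent_zero by blast
  then have xx: "B x x = 1"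
    using normalise[of b1] pos[of b1] b by (simp add: x_def)
  have xS: "x \<in> S"
    using b S by (simp add: x_def subspace_scale)
  define y' where "y' = b2 - B x b2 *\<^sub>R x"
  have "b2 \<notin> span {b1}"
    using b(3,4) independent_insert[of b2 "{b1}"] by (auto simp: insert_commute)
  then have "y' \<noteq> 0"
    by (auto simp: y'_def x_def span_singleton)
  moreover have "y' \<in> S"
    using b S xS by (simp add: y'_def subspace_scale subspace_diff)
  ultimately have y'_pos: "B y' y' > 0"
    by (rule pos[rotated])
  define y where "y = y' /\<^sub>R sqrt \<bar>B y' y'\<bar>"
  have yy: "B y y = 1"
    using normalise[of y'] y'_pos by (simp add: y_def)
  have "B x y' = 0"
    by (simp add: y'_def B_simps xx)
  then have xy: "B x y = 0"
    by (simp add: y_def B_simps)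
  obtain n where n: "B n n < 0"
    using N neg by (metis dim_eq_0 subset_singleton_iff zero_neq_one subsetI singletonI)
  \<comment> \<open>Removing the components along \<open>x\<close> and \<open>y\<close> subtracts
    two squares from \<open>B n n\<close>, so the vector stays timelike.\<close>
  define z' where "z' = n - B x n *\<^sub>R x - B y n *\<^sub>R y"
  have xz': "B x z' = 0" and yz': "B y z' = 0"
    by (simp_all add: z'_def B_simps xx yy xy sym[of y x])
  have "B z' z' = B n z'"
    using xz' yz' by (subst z'_def) (simp add: B_simps)
  also have "\<dots> = B n n - (B x n)\<^sup>2 - (B y n)\<^sup>2"
    by (simp add: z'_def B_simps sym[of n x] sym[of n y] power2_eq_square)
  finally have z'_neg: "B z' z' < 0"
    using n by (smt (verit) zero_le_power2)
  define z where "z = z' /\<^sub>R sqrt \<bar>B z' z'\<bar>"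
  have "B z z = - 1"
    using normalise[of z'] z'_neg by (simp add: z_def)
  moreover have "B x z = 0" "B y z = 0"
    by (simp_all add: z_def B_simps xz' yz')
  ultimately show ?thesis
    using xx yy xy by (auto simp: orthonormal_triple_def)
qed

lemma ex_orthonormal_triple_aligned:
  fixes B :: "real^3 \<Rightarrow> real^3 \<Rightarrow> real"
  assumes B: "bilinear B" and sym: "\<And>u v. B u v = B v u" and sig: "signature B = (2, 1)"
  obtains x y z r c where "orthonormal_triple B x y z" "r \<ge> 0" "c \<ge> 0" "v = r *\<^sub>R x + c *\<^sub>R z"
proof -
  note B_simps = bilinear_simps[OF B]
  obtain x y z where t: "orthonormal_triple B x y z"
    using ex_orthonormal_triple[OF B sym sig] by blast
  obtain a b c where v: "v = a *\<^sub>R x + b *\<^sub>R y + c *\<^sub>R z"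
    using orthonormal_triple_expansion[OF B sym t] .
  define r where "r = sqrt (a\<^sup>2 + b\<^sup>2)"
  \<comment> \<open>\<open>p\<close> and \<open>q\<close> are the cosine and sine of the polar angle
    of \<open>(a, b)\<close>. At \<open>r = 0\<close> every angle works, and angle zero is
    chosen.\<close>
  obtain p q where pq: "p\<^sup>2 + q\<^sup>2 = 1" "a = r * p" "b = r * q"
  proof (cases "r = 0")
    case True
    then show ?thesis using that[of 1 0] by (simp add: r_def)
  next
    case False
    then have "r\<^sup>2 = a\<^sup>2 + b\<^sup>2" "r\<^sup>2 \<noteq> 0" by (simp_all add: r_def)
    then show ?thesis
      using that[of "a / r" "b / r"] False
      by (simp add: power_divide add_divide_distrib[symmetric])
  qed
  define e :: real where "e = (if c \<ge> 0 then 1 else - 1)"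
  have e: "e * e = 1" "\<bar>c\<bar> * e = c" by (auto simp: e_def)
  show ?thesis
  proof (rule that[of "p *\<^sub>R x + q *\<^sub>R y" "(- q) *\<^sub>R x + p *\<^sub>R y" "e *\<^sub>R z" r "\<bar>c\<bar>"])
    show "orthonormal_triple B (p *\<^sub>R x + q *\<^sub>R y) ((- q) *\<^sub>R x + p *\<^sub>R y) (e *\<^sub>R z)"
      using t sym[of y x] sym[of z x] sym[of z y] pq(1) e(1)
      by (simp add: orthonormal_triple_def B_simps power2_eq_square algebra_simps)
    show "v = r *\<^sub>R (p *\<^sub>R x + q *\<^sub>R y) + \<bar>c\<bar> *\<^sub>R e *\<^sub>R z"
      using e(2) by (simp add: v pq(2,3) algebra_simps)
  qed (simp_all add: r_def)
qed

text \<open>\<open>p\<close> and \<open>q\<close> act as hyperbolic cosine and sine (up to a common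
  sign); the mixed terms cancel by symmetry and the norms are multiplied by
  \<open>p\<^sup>2 - q\<^sup>2\<close>.\<close>

lemma orthonormal_triple_boost:
  assumes B: "bilinear B" and sym: "\<And>u v. B u v = B v u"
    and t: "orthonormal_triple B x y z" and p: "p\<^sup>2 - q\<^sup>2 = 1"
  shows "orthonormal_triple B (p *\<^sub>R x + q *\<^sub>R z) y (q *\<^sub>R x + p *\<^sub>R z)"
  using t p sym[of y x] sym[of z x] sym[of z y]
  by (simp add: orthonormal_triple_def bilinear_simps[OF B] power2_eq_square algebra_simps)

text \<open>For the boosted vectors \<open>x' = p x + q z\<close> and \<open>z' = q x + p z\<close>,
  the last two equations say \<open>x' + l z' = s (r x + c z)\<close>. Comparing norms gives
  \<open>1 - l\<^sup>2 = s\<^sup>2 (r\<^sup>2 - c\<^sup>2)\<close>: the sign of \<open>r - c\<close>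
  decides \<open>l\<close>, and \<open>s\<close> is then determined unless
  \<open>l = 1\<close>.\<close>

lemma ex_boost_parameters:
  fixes r c :: real
  assumes "r \<ge> 0" "c \<ge> 0" "(r, c) \<noteq> (0, 0)"
  obtains l s p q where "l \<in> {0, 1, 2}" "s > 0" "p\<^sup>2 - q\<^sup>2 = 1" "p + l * q = s * r" "q + l * p = s * c"
proof -
  consider "c < r" | "c = r" "r > 0" | "r < c" using assms by fastforce
  then show ?thesis
  proof cases
    case 1
    then have d: "r\<^sup>2 - c\<^sup>2 > 0" using assms by (simp add: power_strict_mono)
    define s where "s = 1 / sqrt (r\<^sup>2 - c\<^sup>2)"
    have "s\<^sup>2 * (r\<^sup>2 - c\<^sup>2) = 1" "s > 0" using d by (simp_all add: s_def power_divide)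
    then show ?thesis
      by (intro that[of 0 s "s * r" "s * c"]) (simp_all add: power_mult_distrib algebra_simps)
  next
    case 2
    \<comment> \<open>In the lightlike case the identity boost suffices, with \<open>s\<close> a
      mere rescaling.\<close>
    then show ?thesis by (intro that[of 1 "1 / r" 1 0]) simp_all
  next
    case 3
    then have d: "c\<^sup>2 - r\<^sup>2 > 0" using assms by (simp add: power_strict_mono)
    define s where "s = sqrt 3 / sqrt (c\<^sup>2 - r\<^sup>2)"
    have s: "s\<^sup>2 * (c\<^sup>2 - r\<^sup>2) = 3" "s > 0"
      using d by (simp_all add: s_def power_divide field_simps del: diff_gt_0_iff_gt)
    \<comment> \<open>These are the solutions \<open>p\<close> and \<open>q\<close> of the linear
      system \<open>p + 2 q = s r\<close>, \<open>q + 2 p = s c\<close>.\<close>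
    have "(s * (2 * c - r) / 3)\<^sup>2 - (s * (2 * r - c) / 3)\<^sup>2 = s\<^sup>2 * (c\<^sup>2 - r\<^sup>2) / 3"
      by (simp add: power2_eq_square field_simps)
    with s show ?thesis
      by (intro that[of 2 s "s * (2 * c - r) / 3" "s * (2 * r - c) / 3"]) (simp_all add: field_simps)
  qed
qed

lemma ex_orthonormal_triple_central:
  fixes B :: "real^3 \<Rightarrow> real^3 \<Rightarrow> real"
  assumes B: "bilinear B" and sym: "\<And>u v. B u v = B v u" and sig: "signature B = (2, 1)"
    and v: "v \<noteq> 0"
  obtains l s x y z where "l \<in> {0, 1, 2}" "s > 0" "orthonormal_triple B x y z" "x + l *\<^sub>R z = s *\<^sub>R v"
proof -
  obtain x y z r c where t: "orthonormal_triple B x y z" and rc: "r \<ge> 0" "c \<ge> 0"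
    and v_eq: "v = r *\<^sub>R x + c *\<^sub>R z"
    using ex_orthonormal_triple_aligned[OF B sym sig] .
  have "(r, c) \<noteq> (0, 0)" using v v_eq by auto
  with rc obtain l s p q where l: "l \<in> {0, 1, 2}" "s > 0" and p: "p\<^sup>2 - q\<^sup>2 = 1"
    and pq: "p + l * q = s * r" "q + l * p = s * c"
    by (rule ex_boost_parameters)
  have "(p *\<^sub>R x + q *\<^sub>R z) + l *\<^sub>R (q *\<^sub>R x + p *\<^sub>R z) = (p + l * q) *\<^sub>R x + (q + l * p) *\<^sub>R z"
    by (simp add: algebra_simps)
  also have "\<dots> = s *\<^sub>R v" by (simp add: pq v_eq algebra_simps)
  finally show ?thesis
    using that l orthonormal_triple_boost[OF B sym t p] by blast
qed

lemma heis_bracket_swap: "heis_bracket y x = - heis_bracket x y"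
  by (simp add: heis_bracket_def vec_eq_iff algebra_simps)

lemma heis_bracket_central: "heis_bracket (axis 1 1) v = 0"
  by (simp add: heis_bracket_def axis_def)

theorem theorem1p3:
  fixes B :: "real^3 \<Rightarrow> real^3 \<Rightarrow> real"
  assumes "inner_product B" and "signature B = (2, 1)"
  shows "\<exists>k::real. \<exists>l::real. \<exists>x :: 3 \<Rightarrow> real^3.
    k > 0 \<and> l \<in> {0, 1, 2} \<and>
    pseudo_orthonormal_basis (\<lambda>u v. k * B u v) x \<and>
    heis_bracket (x 1) (x 2) = l *\<^sub>R (x 1 + l *\<^sub>R x 3) \<and>
    heis_bracket (x 2) (x 3) = x 1 + l *\<^sub>R x 3 \<and>
    heis_bracket (x 3) (x 1) = 0"
proof -
  have B: "bilinear B" and sym: "B u v = B v u" for u v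
    using assms(1) by (auto simp: inner_product_def)
  note B_simps = bilinear_simps[OF B]
  note H_simps = bilinear_simps[OF bilinear_heis_bracket]
  have "axis 1 1 \<noteq> (0 :: real^3)" by (simp add: axis_eq_0_iff)
  then obtain l s x y z where l: "l \<in> {0, 1, 2}" and s: "s > 0"
    and t: "orthonormal_triple B x y z" and c: "x + l *\<^sub>R z = s *\<^sub>R axis 1 1"
    using ex_orthonormal_triple_central[OF B sym assms(2)] by blast
  \<comment> \<open>Modulo the centre \<open>x\<close> equals \<open>- l z\<close>, so its brackets
    reduce to those of \<open>z\<close>.\<close>
  have x: "x = s *\<^sub>R axis 1 1 - l *\<^sub>R z"
    using c by (simp add: algebra_simps)
  have xy: "heis_bracket x y = l *\<^sub>R heis_bracket y z"
    unfolding x by (simp add: H_simps(7) H_simps(3) heis_bracket_central heis_bracket_swap[of z y])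
  have zx: "heis_bracket z x = 0"
    using heis_bracket_central[of z] heis_bracket_swap[of z "axis 1 1"]
    unfolding x by (simp add: H_simps(8) H_simps(4) heis_bracket_self)
  define w where "w = y $ 2 * z $ 3 - y $ 3 * z $ 2"
  have yz: "heis_bracket y z = w *\<^sub>R axis 1 1"
    by (simp add: heis_bracket_def w_def)
  \<comment> \<open>Otherwise the bracket vanishes on a basis, hence everywhere, although
    \<open>[e2, e3] = e1\<close> is nonzero.\<close>
  have "w \<noteq> 0"
  proof
    assume "w = 0"
    then have zero: "heis_bracket y z = 0" "heis_bracket x y = 0" "heis_bracket z x = 0"
      "heis_bracket z y = 0" "heis_bracket y x = 0" "heis_bracket x z = 0"
      using yz xy zx heis_bracket_swap[of z y] heis_bracket_swap[of y x] heis_bracket_swap[of x z]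
      by simp_all
    have "heis_bracket u v = 0" for u v
    proof -
      obtain a b c where u: "u = a *\<^sub>R x + b *\<^sub>R y + c *\<^sub>R z"
        by (rule orthonormal_triple_expansion[OF B sym t])
      obtain a' b' c' where v: "v = a' *\<^sub>R x + b' *\<^sub>R y + c' *\<^sub>R z"
        by (rule orthonormal_triple_expansion[OF B sym t])
      show ?thesis
        unfolding u v by (simp add: H_simps zero heis_bracket_self)
    qed
    then show False
      using heis_bracket_basis(1) \<open>axis 1 1 \<noteq> 0\<close> by metis
  qed
  \<comment> \<open>Scaling the triple by \<open>m\<close> multiplies the bracket by \<open>m\<^sup>2\<close> and the central vector by \<open>m\<close>, so
    \<open>m\<^sup>2 \<bar>w\<bar> = m s\<close> is needed; the sign of \<open>w\<close> is absorbed by the reflection \<open>y \<mapsto> - y\<close>.\<close>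
  define m where "m = s / \<bar>w\<bar>"
  have m: "m > 0" "m * \<bar>w\<bar> = s"
    using s \<open>w \<noteq> 0\<close> by (simp_all add: m_def)
  have my: "m * m * sgn w * w = m * s"
    using m(2) by (auto simp: abs_sgn mult_ac)
  define f :: "3 \<Rightarrow> real^3" where
    "f i = (if i = 1 then m *\<^sub>R x else if i = 2 then (m * sgn w) *\<^sub>R y else m *\<^sub>R z)" for i
  have f: "f 1 = m *\<^sub>R x" "f 2 = (m * sgn w) *\<^sub>R y" "f 3 = m *\<^sub>R z"
    by (simp_all add: f_def)
  have fc: "f 1 + l *\<^sub>R f 3 = (m * s) *\<^sub>R axis 1 1"
    using arg_cong[OF c, of "scaleR m"] by (simp add: f scaleR_add_right mult.commute)
  have "sgn w * sgn w = 1"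
    using \<open>w \<noteq> 0\<close> by (simp add: sgn_real_def)
  \<comment> \<open>Stretching the vectors by \<open>m\<close> multiplies their norms by
    \<open>m\<^sup>2\<close>, which the factor \<open>k = 1 / m\<^sup>2\<close> undoes.\<close>
  then have "orthonormal_triple (\<lambda>u v. (1 / m\<^sup>2) * B u v) (f 1) (f 2) (f 3)"
    using t m(1) unfolding f
    by (simp add: orthonormal_triple_def B_simps power2_eq_square)
  then have "pseudo_orthonormal_basis (\<lambda>u v. (1 / m\<^sup>2) * B u v) f"
    by (intro pseudo_orthonormal_basis_of_triple bilinear_scale B) (simp_all add: sym)
  moreover have "heis_bracket (f 2) (f 3) = f 1 + l *\<^sub>R f 3"
    unfolding fc by (simp only: f H_simps yz scaleR_scaleR my[symmetric] mult_ac)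
  moreover have "heis_bracket (f 1) (f 2) = l *\<^sub>R (f 1 + l *\<^sub>R f 3)"
    unfolding fc by (simp only: f H_simps xy yz scaleR_scaleR my[symmetric] mult_ac)
  moreover have "heis_bracket (f 3) (f 1) = 0"
    by (simp add: f H_simps zx)
  ultimately show ?thesis
    using l m(1) by (intro exI[of _ "1 / m\<^sup>2"] exI[of _ l] exI[of _ f]) simp
qed

end
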